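(* Let $g=0$ and let $f,A$ be as in the context. Let $b>1$ and $\beta_k=b^k$ for every $k$. Suppose the iterates of the (second-order) inexact augmented Lagrangian method (iALM) described in the context satisfy $\rho:=\sup_{k\ge 2}\|x_k\|<\infty$ and, for some $\nu>0$, $$\nu\|A(x_k)\|\le\|DA(x_k)^\top A(x_k)\|\qquad\text{for every }k\ge2 .$$ Assume that there is $L_u$ such that, for every outer iteration $k$, with $x^{(k)}$ denoting the point at which the inner solver is initialized at outer iteration $k$, $$\mathcal{L}_{\beta_k}(x^{(k)},y_k)-\min_x\mathcal{L}_{\beta_k}(x,y_k)\le L_u .$$ Suppose Step 2 of iALM is carried out by the second-order trust region method with the oracle-complexity guarantee stated in the context. Then, as $\epsilon\to0$, iALM finds an $\epsilon$-second-order stationary point (i.e. an $(\epsilon,\epsilon,\beta_k)$ second-order stationary point, $k$ being the corresponding outer iteration) in a total of $T$ calls to the second-order oracle, where $$T=\mathcal{O}\left(\frac{L_uQ'^5}{\epsilon^5}\log_b\Big(\frac{Q'}{\epsilon}\Big)\right)=\tilde{\mathcal{O}}\left(\frac{L_uQ'^5}{\epsilon^5}\right),\qquad Q'=\frac{\nu+\sigma_1\sqrt m\,\lambda_A(2\lambda'_f+2\lambda'_Ay_{\max})}{\nu},$$ and the implied constant may depend on the problem data and algorithm parameters but not on $\epsilon$ or $L_u$.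
   Context: Problem: minimize $f(x)$ over $x\in\mathbb{R}^d$ subject to $A(x)=0$, where $f:\mathbb{R}^d\to\mathbb{R}$ and $A:\mathbb{R}^d\to\mathbb{R}^m$ are twice differentiable and for some $\lambda_f,\lambda_A\ge0$: $\|\nabla f(x)-\nabla f(x')\|\le\lambda_f\|x-x'\|$ and $\|DA(x)-DA(x')\|\le\lambda_A\|x-x'\|$ for all $x,x'\in\mathbb{R}^d$. $\|\cdot\|$ is the Euclidean norm on vectors and the spectral norm on matrices; $DA(x)\in\mathbb{R}^{m\times d}$ is the Jacobian; $\lambda_{\min}$ is the smallest eigenvalue. $\tilde{\mathcal{O}}$ suppresses logarithmic factors. Augmented Lagrangian: $\mathcal{L}_\beta(x,y)=f(x)+\langle A(x),y\rangle+\frac\beta2\|A(x)\|^2$, with gradient $\nabla_x\mathcal{L}_\beta$ and Hessian $\nabla_{xx}\mathcal{L}_\beta$ in $x$. Stationarity: $x$ is an $(\epsilon_f,\epsilon_s,\beta)$ second-order stationary point if there exists $y\in\mathbb{R}^m$ with $\|\nabla_x\mathcal{L}_\beta(x,y)\|\le\epsilon_f$, $\|A(x)\|\le\epsilon_f$ and $\lambda_{\min}(\nabla_{xx}\mathcal{L}_\beta(x,y))\ge-\epsilon_s$. Algorithm (iALM, second-order version). Given $\{\beta_k\}_{k\ge1}$, $x_1\in\mathbb{R}^d$, $y_0\in\mathbb{R}^m$, $\sigma_1>0$, set $y_1=y_0+\sigma_1A(x_1)$. For $k=1,2,\dots$: Step 1: $\epsilon_{k+1}=1/\beta_k$. Step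 2: obtain $x_{k+1}$ with $\|\nabla_x\mathcal{L}_{\beta_k}(x_{k+1},y_k)\|\le\epsilon_{k+1}$ and $\lambda_{\min}(\nabla_{xx}\mathcal{L}_{\beta_k}(x_{k+1},y_k))\ge-\epsilon_{k+1}$. Step 3: $\sigma_{k+1}=\sigma_1\min\big(\frac{\|A(x_1)\|\log^22}{\|A(x_{k+1})\|(k+1)\log^2(k+2)},1\big)$ (the minimum is $1$ if $A(x_{k+1})=0$). Step 4: $y_{k+1}=y_k+\sigma_{k+1}A(x_{k+1})$. Constants: $\lambda'_f=\max_{\|x\|\le\rho}\|\nabla f(x)\|$, $\lambda'_A=\max_{\|x\|\le\rho}\|DA(x)\|$, $y_{\max}=\|y_0\|+c\|A(x_1)\|$ with $c=\sigma_1\log^22\sum_{i\ge1}\frac1{i\log^2(i+1)}$. Trust region guarantee (from the literature, taken as given): at outer iteration $k$, started at $x^{(k)}$, the method produces $x_{k+1}$ satisfying Step 2 using at most $$C\,\frac{\lambda_{\beta_k,H}^2\big(\mathcal{L}_{\beta_k}(x^{(k)},y_k)-\min_x\mathcal{L}_{\beta_k}(x,y_k)\big)}{\epsilon_{k+1}^3}$$ calls to the second-order oracle, where $C$ is an absolute constant and $\lambda_{\beta_k,H}$ is the Lipschitz constant of the Hessian $\nabla_{xx}\mathcal{L}_{\beta_k}(\cdot,y_k)$, which is assumed to be of order $\beta_k$, i.e. $\lambda_{\beta_k,H}\le C_H\beta_k$ with $C_H$ independent of $k$. The total number $T$ is the sum of oracle calls over all outer iterations performed. *)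

theory Defs
  imports "HOL-Analysis.Analysis" "HOL-Library.Landau_Symbols"
begin

definition gradient :: "(real^'d \<Rightarrow> real) \<Rightarrow> real^'d \<Rightarrow> real^'d" where
  "gradient f x = (THE D. GDERIV f x :> D)"

definition hessian :: "(real^'d \<Rightarrow> real) \<Rightarrow> real^'d \<Rightarrow> real^'d^'d" where
  "hessian f x = jacobian (gradient f) (at x)"

(* The library norm on real^'d^'m is the Frobenius norm, hence the operator norm here. *)
definition spectral_norm :: "real^'d^'m \<Rightarrow> real" where
  "spectral_norm M = onorm ((*v) M)"

definition spectral_lipschitz :: "real \<Rightarrow> (real^'d \<Rightarrow> real^'n^'m) \<Rightarrow> bool" where
  "spectral_lipschitz L F \<longleftrightarrow>
     0 \<le> L \<and> (\<forall>x x'. spectral_norm (F x - F x') \<le> L * norm (x - x'))"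

(* Only applied to Hessians of twice differentiable functions; these are symmetric, so the set
   of real eigenvalues is finite and nonempty. *)
definition lambda_min :: "real^'d^'d \<Rightarrow> real" where
  "lambda_min M = Min {l. \<exists>v. v \<noteq> 0 \<and> M *v v = l *\<^sub>R v}"

definition aug_lagrangian ::
  "(real^'d \<Rightarrow> real) \<Rightarrow> (real^'d \<Rightarrow> real^'m) \<Rightarrow> real \<Rightarrow> real^'m \<Rightarrow> real^'d \<Rightarrow> real" where
  "aug_lagrangian f A \<beta> y x = f x + A x \<bullet> y + \<beta> / 2 * (norm (A x))\<^sup>2"

definition second_order_stationary ::
  "(real^'d \<Rightarrow> real) \<Rightarrow> (real^'d \<Rightarrow> real^'m) \<Rightarrow> real \<Rightarrow> real \<Rightarrow> real \<Rightarrow> real^'d \<Rightarrow> bool" where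
  "second_order_stationary f A \<epsilon>f \<epsilon>s \<beta> x \<longleftrightarrow>
     (\<exists>y. norm (gradient (aug_lagrangian f A \<beta> y) x) \<le> \<epsilon>f \<and>
          norm (A x) \<le> \<epsilon>f \<and>
          lambda_min (hessian (aug_lagrangian f A \<beta> y) x) \<ge> - \<epsilon>s)"

(* A run of the method. Indices are those of the algorithm, so iter and dual_step are meaningful
   from 1, accuracy from 2, and dual from 0; inner_start k and calls k are the point at which the
   inner solver is initialized at outer iteration k >= 1 (the iteration that computes
   iter (k + 1)) and the number of oracle calls it then makes. *)
record ('d::finite, 'm::finite) ialm_run =
  iter :: "nat \<Rightarrow> real^'d"
  dual :: "nat \<Rightarrow> real^'m"
  dual_step :: "nat \<Rightarrow> real"
  accuracy :: "nat \<Rightarrow> real"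
  inner_start :: "nat \<Rightarrow> real^'d"
  calls :: "nat \<Rightarrow> nat"

definition is_ialm_run ::
  "(real^'d \<Rightarrow> real) \<Rightarrow> (real^'d \<Rightarrow> real^'m) \<Rightarrow> (nat \<Rightarrow> real) \<Rightarrow> real^'d \<Rightarrow> real^'m \<Rightarrow> real \<Rightarrow>
   ('d::finite, 'm::finite) ialm_run \<Rightarrow> bool" where
  "is_ialm_run f A \<beta> x\<^sub>1 y\<^sub>0 \<sigma>\<^sub>1 r \<longleftrightarrow>
     iter r 1 = x\<^sub>1 \<and> dual r 0 = y\<^sub>0 \<and> dual_step r 1 = \<sigma>\<^sub>1 \<and> dual r 1 = y\<^sub>0 + \<sigma>\<^sub>1 *\<^sub>R A x\<^sub>1 \<and>
     (\<forall>k\<ge>1.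
        accuracy r (k + 1) = 1 / \<beta> k \<and>
        norm (gradient (aug_lagrangian f A (\<beta> k) (dual r k)) (iter r (k + 1)))
          \<le> accuracy r (k + 1) \<and>
        lambda_min (hessian (aug_lagrangian f A (\<beta> k) (dual r k)) (iter r (k + 1)))
          \<ge> - accuracy r (k + 1) \<and>
        dual_step r (k + 1) =
          (if A (iter r (k + 1)) = 0 then \<sigma>\<^sub>1
           else \<sigma>\<^sub>1 * min (norm (A x\<^sub>1) * (ln 2)\<^sup>2 /
                  (norm (A (iter r (k + 1))) * real (k + 1) * (ln (real (k + 2)))\<^sup>2)) 1) \<and>
        dual r (k + 1) = dual r k + dual_step r (k + 1) *\<^sub>R A (iter r (k + 1)))"

(* Initial suboptimality of the k-th subproblem. The infimum is the minimum whenever the latter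
   exists; boundedness from below has to be required separately. *)
definition initial_gap ::
  "(real^'d \<Rightarrow> real) \<Rightarrow> (real^'d \<Rightarrow> real^'m) \<Rightarrow> (nat \<Rightarrow> real) \<Rightarrow>
   ('d::finite, 'm::finite) ialm_run \<Rightarrow> nat \<Rightarrow> real" where
  "initial_gap f A \<beta> r k =
     aug_lagrangian f A (\<beta> k) (dual r k) (inner_start r k)
       - (INF x. aug_lagrangian f A (\<beta> k) (dual r k) x)"

(* L_H is a Lipschitz constant of the Hessian of the k-th subproblem; any admissible value, in
   particular the smallest one, may be used. *)
definition trust_region_guarantee ::
  "(real^'d \<Rightarrow> real) \<Rightarrow> (real^'d \<Rightarrow> real^'m) \<Rightarrow> (nat \<Rightarrow> real) \<Rightarrow> real \<Rightarrow> real \<Rightarrow>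
   ('d::finite, 'm::finite) ialm_run \<Rightarrow> bool" where
  "trust_region_guarantee f A \<beta> C C\<^sub>H r \<longleftrightarrow>
     (\<forall>k\<ge>1. \<exists>L\<^sub>H.
        spectral_lipschitz L\<^sub>H (hessian (aug_lagrangian f A (\<beta> k) (dual r k))) \<and>
        L\<^sub>H \<le> C\<^sub>H * \<beta> k \<and>
        real (calls r k) \<le> C * (L\<^sub>H\<^sup>2 * initial_gap f A \<beta> r k / accuracy r (k + 1) ^ 3))"

(* First outer iteration whose output is an epsilon-second-order stationary point. *)
definition final_iteration ::
  "(real^'d \<Rightarrow> real) \<Rightarrow> (real^'d \<Rightarrow> real^'m) \<Rightarrow> (nat \<Rightarrow> real) \<Rightarrow>
   ('d::finite, 'm::finite) ialm_run \<Rightarrow> real \<Rightarrow> nat" where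
  "final_iteration f A \<beta> r \<epsilon> =
     (LEAST k. k \<ge> 1 \<and> second_order_stationary f A \<epsilon> \<epsilon> (\<beta> k) (iter r (k + 1)))"

definition total_calls ::
  "(real^'d \<Rightarrow> real) \<Rightarrow> (real^'d \<Rightarrow> real^'m) \<Rightarrow> (nat \<Rightarrow> real) \<Rightarrow>
   ('d::finite, 'm::finite) ialm_run \<Rightarrow> real \<Rightarrow> nat" where
  "total_calls f A \<beta> r \<epsilon> = (\<Sum>k = 1..final_iteration f A \<beta> r \<epsilon>. calls r k)"

(* Suprema of continuous functions over a compact ball, hence maxima. *)
definition max_gradient :: "(real^'d \<Rightarrow> real) \<Rightarrow> real \<Rightarrow> real" where
  "max_gradient f \<rho> = (SUP x\<in>cball 0 \<rho>. norm (gradient f x))"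

definition max_jacobian :: "(real^'d \<Rightarrow> real^'m) \<Rightarrow> real \<Rightarrow> real" where
  "max_jacobian A \<rho> = (SUP x\<in>cball 0 \<rho>. spectral_norm (jacobian A (at x)))"

(* The series over i >= 1, shifted to start at 0. *)
definition dual_bound ::
  "(real^'d \<Rightarrow> real^'m) \<Rightarrow> real^'d \<Rightarrow> real^'m \<Rightarrow> real \<Rightarrow> real" where
  "dual_bound A x\<^sub>1 y\<^sub>0 \<sigma>\<^sub>1 =
     norm y\<^sub>0 + \<sigma>\<^sub>1 * (ln 2)\<^sup>2 * (\<Sum>i. 1 / (real (i + 1) * (ln (real (i + 2)))\<^sup>2)) * norm (A x\<^sub>1)"

end

theory Submission
  imports Defs "HOL-Real_Asymp.Real_Asymp"
begin

text \<open>
  By the regularity condition, approximate stationarity of \<open>x\<^sub>k\<^sub>+\<^sub>1\<close> for the \<open>k\<close>-th subproblem, with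
  gradients and dual variables bounded uniformly, forces \<open>\<parallel>A x\<^sub>k\<^sub>+\<^sub>1\<parallel> \<le> K / \<beta>\<^sub>k\<close>. Hence the method stops
  at the latest when \<open>b\<^sup>k \<ge> K / \<epsilon>\<close>. Iteration \<open>k\<close> costs at most a multiple of \<open>L\<^sub>u \<beta>\<^sub>k\<^sup>5\<close> calls, and a
  geometric sum is dominated by its last term, so the total is of order \<open>L\<^sub>u / \<epsilon>\<^sup>5\<close>. Since \<open>Q' \<ge> 1\<close>,
  this implies both bounds, the second one with exponent \<open>0\<close> for the logarithm.
\<close>

section \<open>Gradients and the augmented Lagrangian\<close>

lemma GDERIV_eq_gradient:
  assumes "GDERIV f x :> D"
  shows "gradient f x = D"
  unfolding gradient_def
proof (rule the_equality)
  fix D' assume "GDERIV f x :> D'"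
  then have "(\<lambda>h. h \<bullet> D') = (\<lambda>h. h \<bullet> D)"
    using assms unfolding gderiv_def by (rule has_derivative_unique)
  then show "D' = D"
    by (metis vector_eq_rdot inner_commute)
qed (fact assms)

lemma GDERIV_gradient:
  fixes f :: "real^'d \<Rightarrow> real"
  assumes "f differentiable at x"
  shows "GDERIV f x :> gradient f x"
proof -
  obtain f' where f': "(f has_derivative f') (at x)"
    using assms unfolding differentiable_def by blast
  \<comment> \<open>Riesz representation: the adjoint applied to 1 is the vector representing the
    functional \<open>f'\<close>.\<close>
  have "f' = (\<lambda>h. h \<bullet> adjoint f' 1)"
    using adjoint_works[OF has_derivative_linear[OF f'], of _ 1] by auto
  with f' have "GDERIV f x :> adjoint f' 1"
    unfolding gderiv_def by simp
  then show ?thesis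
    using GDERIV_eq_gradient by metis
qed

text \<open>Product and chain rules; \<open>w v* M\<close> is the transpose of \<open>M\<close>
  applied to \<open>w\<close>. The last summand is the penalty part, which later controls
  infeasibility.\<close>

lemma gradient_aug_lagrangian:
  fixes f :: "real^'d \<Rightarrow> real" and A :: "real^'d \<Rightarrow> real^'m"
  assumes "f differentiable at x" and "A differentiable at x"
  shows "gradient (aug_lagrangian f A \<beta> y) x =
    gradient f x + y v* jacobian A (at x) + \<beta> *\<^sub>R (A x v* jacobian A (at x))"
proof (rule GDERIV_eq_gradient)
  have f: "(f has_derivative (\<lambda>h. h \<bullet> gradient f x)) (at x)"
    using GDERIV_gradient[OF assms(1)] unfolding gderiv_def .
  have A: "(A has_derivative (\<lambda>h. jacobian A (at x) *v h)) (at x)"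
    using assms(2) jacobian_works by blast
  have adj: "h \<bullet> (w v* M) = w \<bullet> (M *v h)" for h w and M :: "real^'d^'m"
    by (metis dot_lmul_matrix inner_commute)
  have eq: "aug_lagrangian f A \<beta> y = (\<lambda>x. f x + A x \<bullet> y + \<beta> / 2 * (A x \<bullet> A x))"
    by (auto simp: aug_lagrangian_def power2_norm_eq_inner)
  show "GDERIV (aug_lagrangian f A \<beta> y) x :>
    gradient f x + y v* jacobian A (at x) + \<beta> *\<^sub>R (A x v* jacobian A (at x))"
    unfolding gderiv_def eq
    by (rule derivative_eq_intros f A refl)+
      (auto simp: fun_eq_iff inner_add_right adj inner_commute algebra_simps)
qed

section \<open>Spectral norm and maxima over the ball\<close>

lemma spectral_norm_nonneg: "0 \<le> spectral_norm M"
  unfolding spectral_norm_def by (simp add: onorm_pos_le)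

lemma spectral_norm_add_le: "spectral_norm (M + N) \<le> spectral_norm M + spectral_norm N"
  unfolding spectral_norm_def
  using onorm_triangle[of "(*v) M" "(*v) N"]
  by (simp add: matrix_vector_mult_add_rdistrib[abs_def])

text \<open>Transposition does not increase the operator norm: pair \<open>w v* M\<close> with
  itself, move \<open>M\<close> across, apply Cauchy-Schwarz, and cancel one factor.\<close>

lemma norm_vector_matrix_mult_le: "norm (w v* M) \<le> spectral_norm M * norm w"
  for M :: "real^'d^'m"
proof -
  have "(norm (w v* M))\<^sup>2 = w \<bullet> (M *v (w v* M))"
    by (simp add: power2_norm_eq_inner dot_lmul_matrix)
  also have "\<dots> \<le> norm w * norm (M *v (w v* M))"
    by (rule norm_cauchy_schwarz)
  also have "\<dots> \<le> norm w * (spectral_norm M * norm (w v* M))"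
    unfolding spectral_norm_def by (intro mult_left_mono onorm) auto
  finally have "norm (w v* M) * norm (w v* M) \<le> (spectral_norm M * norm w) * norm (w v* M)"
    by (simp add: power2_eq_square mult_ac)
  then show ?thesis
    by (cases "w v* M = 0") (auto simp: spectral_norm_nonneg)
qed

text \<open>The supremum is an upper bound only if the values are bounded; continuity on the compact
  ball ensures this.\<close>

lemma norm_gradient_le_max:
  fixes f :: "real^'d \<Rightarrow> real"
  assumes "L-lipschitz_on UNIV (gradient f)" and "norm x \<le> \<rho>"
  shows "norm (gradient f x) \<le> max_gradient f \<rho>"
  unfolding max_gradient_def
proof (rule cSUP_upper)
  have "continuous_on (cball 0 \<rho>) (\<lambda>x. norm (gradient f x))"
    using lipschitz_on_continuous_on[OF assms(1)]
    by (intro continuous_intros) (auto intro: continuous_on_subset)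
  then show "bdd_above ((\<lambda>x. norm (gradient f x)) ` cball 0 \<rho>)"
    by (intro bounded_imp_bdd_above compact_imp_bounded compact_continuous_image) auto
qed (use assms(2) in simp)

text \<open>Boundedness over the ball comes from comparing each Jacobian with the one at the origin,
  directly in the spectral norm.\<close>

lemma spectral_norm_jacobian_le_max:
  fixes A :: "real^'d \<Rightarrow> real^'m"
  assumes L: "spectral_lipschitz L (\<lambda>x. jacobian A (at x))" and "norm x \<le> \<rho>"
  shows "spectral_norm (jacobian A (at x)) \<le> max_jacobian A \<rho>"
  unfolding max_jacobian_def
proof (rule cSUP_upper)
  show "bdd_above ((\<lambda>x. spectral_norm (jacobian A (at x))) ` cball 0 \<rho>)"
  proof (rule bdd_aboveI2)
    fix z :: "real^'d" assume z: "z \<in> cball 0 \<rho>"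
    have "spectral_norm (jacobian A (at z)) \<le>
        spectral_norm (jacobian A (at z) - jacobian A (at 0)) + spectral_norm (jacobian A (at 0))"
      using spectral_norm_add_le[of "jacobian A (at z) - jacobian A (at 0)" "jacobian A (at 0)"]
      by simp
    also have "spectral_norm (jacobian A (at z) - jacobian A (at 0)) \<le> L * norm (z - 0)"
      using L unfolding spectral_lipschitz_def by blast
    also have "\<dots> \<le> L * \<rho>"
      using L z unfolding spectral_lipschitz_def by (intro mult_left_mono) auto
    finally show "spectral_norm (jacobian A (at z)) \<le> L * \<rho> + spectral_norm (jacobian A (at 0))"
      by simp
  qed
qed (use assms(2) in simp)

section \<open>Uniform bound on the dual variables\<close>

text \<open>The discrete form of the integral test with antiderivative -1 / ln: the terms are
  dominated by twice the differences of a null sequence, which telescope.\<close>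

lemma summable_inverse_mult_ln_squared:
  "summable (\<lambda>i. 1 / (real (i + 1) * (ln (real (i + 2)))\<^sup>2))"
proof -
  define g where "g n = 1 / ln (real (n + 2))" for n
  have "g \<longlonglongrightarrow> 0"
    unfolding g_def by real_asymp
  then have sum: "summable (\<lambda>n. 2 * (g n - g (Suc n)))"
    by (intro summable_mult telescope_summable')
  \<comment> \<open>The bound starts at the second term, since for the first one \<open>u\<close>
    would be 1 and \<open>1 / ln u\<close> would lose its meaning.\<close>
  have "norm (1 / (real (Suc n + 1) * (ln (real (Suc n + 2)))\<^sup>2)) \<le> 2 * (g n - g (Suc n))" for n
  proof -
    define u v where "u = real (n + 2)" and "v = real (n + 3)"
    have uv: "u \<ge> 2" "v = u + 1" by (auto simp: u_def v_def)
    have lu: "0 < ln u" and lv: "0 < ln v" and luv: "ln u \<le> ln v" using uv by auto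
    \<comment> \<open>Applied to \<open>u / v\<close> rather than \<open>v / u\<close>, the
      logarithm inequality bounds \<open>ln v - ln u\<close> from below.\<close>
    have "ln (u / v) \<le> u / v - 1"
      by (rule ln_le_minus_one) (use uv in auto)
    then have d: "1 / v \<le> ln v - ln u"
      using uv by (simp add: ln_div field_simps)
    \<comment> \<open>The factor 2 arises from \<open>v = u + 1\<close> being at most
      \<open>2 * u\<close>.\<close>
    have "1 / (u * (ln v)\<^sup>2) \<le> 2 * ((1 / v) / (ln v)\<^sup>2)"
      using uv divide_right_mono[of "1 / u" "2 / v" "(ln v)\<^sup>2"] by (simp add: field_simps)
    also have "\<dots> \<le> 2 * ((ln v - ln u) / (ln v)\<^sup>2)"
      using d by (intro mult_left_mono divide_right_mono) auto
    also have "\<dots> \<le> 2 * ((ln v - ln u) / (ln u * ln v))"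
      using lu lv luv by (intro mult_left_mono divide_left_mono) (auto simp: power2_eq_square)
    also have "\<dots> = 2 * (1 / ln u - 1 / ln v)"
      using lu lv by (simp add: field_simps)
    finally show ?thesis
      by (simp add: g_def u_def v_def add.commute)
  qed
  then have "summable (\<lambda>n. 1 / (real (Suc n + 1) * (ln (real (Suc n + 2)))\<^sup>2))"
    by (intro summable_comparison_test'[OF sum, of 0]) blast
  then show ?thesis
    by (rule iffD1[OF summable_Suc_iff])
qed

lemma dual_bound_nonneg:
  assumes "0 \<le> \<sigma>\<^sub>1"
  shows "0 \<le> dual_bound A x\<^sub>1 y\<^sub>0 \<sigma>\<^sub>1"
  unfolding dual_bound_def using assms
  by (intro add_nonneg_nonneg mult_nonneg_nonneg suminf_nonneg summable_inverse_mult_ln_squared) auto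

text \<open>The step rule caps the length of each dual update by \<open>c\<close> times a term of
  the convergent series, whatever the size of the constraint value, so the dual path has finite
  length.\<close>

lemma norm_dual_le_dual_bound:
  assumes run: "is_ialm_run f A \<beta> x\<^sub>1 y\<^sub>0 \<sigma>\<^sub>1 r" and \<sigma>\<^sub>1: "0 \<le> \<sigma>\<^sub>1" and "1 \<le> k"
  shows "norm (dual r k) \<le> dual_bound A x\<^sub>1 y\<^sub>0 \<sigma>\<^sub>1"
proof -
  define t where "t i = 1 / (real (i + 1) * (ln (real (i + 2)))\<^sup>2)" for i
  define c where "c = \<sigma>\<^sub>1 * (ln 2)\<^sup>2 * norm (A x\<^sub>1)"
  have c: "0 \<le> c" using \<sigma>\<^sub>1 by (simp add: c_def)
  have "norm (dual r k) \<le> norm y\<^sub>0 + c * sum t {..<k}"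
    using \<open>1 \<le> k\<close>
  proof (induction k rule: nat_induct_at_least)
    case base
    have "dual r 1 = y\<^sub>0 + \<sigma>\<^sub>1 *\<^sub>R A x\<^sub>1"
      using run unfolding is_ialm_run_def by blast
    moreover have "norm (y\<^sub>0 + \<sigma>\<^sub>1 *\<^sub>R A x\<^sub>1) \<le> norm y\<^sub>0 + \<sigma>\<^sub>1 * norm (A x\<^sub>1)"
      using norm_triangle_ineq[of y\<^sub>0 "\<sigma>\<^sub>1 *\<^sub>R A x\<^sub>1"] \<sigma>\<^sub>1 by simp
    \<comment> \<open>\<open>t 0\<close> is the inverse of the squared ln 2 contained in
      \<open>c\<close>, so the zeroth term pays exactly for the first update.\<close>
    moreover have "c * sum t {..<1} = \<sigma>\<^sub>1 * norm (A x\<^sub>1)"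
      by (simp add: c_def t_def)
    ultimately show ?case by simp
  next
    case (Suc k)
    define a where "a = A (iter r (k + 1))"
    define l where "l = ln (real (k + 2))"
    have step: "dual_step r (k + 1) = (if a = 0 then \<sigma>\<^sub>1
        else \<sigma>\<^sub>1 * min (norm (A x\<^sub>1) * (ln 2)\<^sup>2 / (norm a * real (k + 1) * l\<^sup>2)) 1)"
      and dual: "dual r (k + 1) = dual r k + dual_step r (k + 1) *\<^sub>R a"
      using run \<open>1 \<le> k\<close> unfolding is_ialm_run_def a_def l_def by blast+
    have "norm (dual_step r (k + 1) *\<^sub>R a) \<le> c * t k"
    proof (cases "a = 0")
      case True
      then show ?thesis using c by (simp add: t_def)
    next
      case False
      have "0 \<le> dual_step r (k + 1)"
        unfolding step using False \<sigma>\<^sub>1 by simp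
      then have "norm (dual_step r (k + 1) *\<^sub>R a) = dual_step r (k + 1) * norm a"
        by simp
      \<comment> \<open>Of the minimum only its first argument is kept; its denominator cancels
        \<open>norm a\<close>.\<close>
      also have "\<dots> \<le> (\<sigma>\<^sub>1 * (norm (A x\<^sub>1) * (ln 2)\<^sup>2 / (norm a * real (k + 1) * l\<^sup>2))) * norm a"
        using False \<sigma>\<^sub>1 unfolding step by (simp only: if_False, intro mult_right_mono mult_left_mono) auto
      also have "\<dots> = c * t k"
        using False by (simp add: c_def t_def l_def mult_ac add.commute)
      finally show ?thesis .
    qed
    then have "norm (dual r (k + 1)) \<le> norm (dual r k) + c * t k"
      unfolding dual by (metis add_left_mono norm_triangle_ineq order_trans)
    with Suc.IH show ?case
      by (simp add: algebra_simps)
  qed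
  also have "c * sum t {..<k} \<le> c * suminf t"
    using summable_inverse_mult_ln_squared c unfolding t_def
    by (intro mult_left_mono sum_le_suminf) auto
  finally show ?thesis
    by (simp add: dual_bound_def c_def t_def[abs_def] mult_ac)
qed

section \<open>Decay of infeasibility\<close>

text \<open>The penalty part of the gradient is the full gradient minus two bounded parts, hence
  bounded independently of \<open>k\<close>. Regularity bounds it below by
  \<open>\<nu> * \<beta> k\<close> times the infeasibility.\<close>

lemma ialm_infeasibility_le:
  fixes f :: "real^'d \<Rightarrow> real" and A :: "real^'d \<Rightarrow> real^'m"
  assumes run: "is_ialm_run f A \<beta> x\<^sub>1 y\<^sub>0 \<sigma>\<^sub>1 r" and \<sigma>\<^sub>1: "0 \<le> \<sigma>\<^sub>1" and k: "1 \<le> k"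
    and diff: "\<forall>x. f differentiable at x" "\<forall>x. A differentiable at x"
    and f_lip: "L\<^sub>f-lipschitz_on UNIV (gradient f)"
    and A_lip: "spectral_lipschitz L\<^sub>A (\<lambda>x. jacobian A (at x))"
    and \<beta>: "1 \<le> \<beta> k" and \<nu>: "0 < \<nu>"
    and reg: "\<nu> * norm (A (iter r (k + 1)))
      \<le> norm (A (iter r (k + 1)) v* jacobian A (at (iter r (k + 1))))"
    and \<rho>: "norm (iter r (k + 1)) \<le> \<rho>"
  shows "norm (A (iter r (k + 1))) \<le>
    (1 + max_gradient f \<rho> + max_jacobian A \<rho> * dual_bound A x\<^sub>1 y\<^sub>0 \<sigma>\<^sub>1) / \<nu> / \<beta> k"
proof -
  define x y J where "x = iter r (k + 1)" and "y = dual r k" and "J = jacobian A (at x)"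
  have "norm (gradient (aug_lagrangian f A (\<beta> k) y) x) \<le> 1 / \<beta> k"
    using run k unfolding is_ialm_run_def x_def y_def by (metis (no_types))
  \<comment> \<open>Replacing the tolerance by 1 yields a constant free of \<open>k\<close>, the
    summand 1 in the claim.\<close>
  also have "\<dots> \<le> 1"
    using \<beta> by simp
  finally have g: "norm (gradient f x + y v* J + \<beta> k *\<^sub>R (A x v* J)) \<le> 1"
    using diff by (simp add: gradient_aug_lagrangian J_def)
  have "norm (y v* J) \<le> spectral_norm J * norm y"
    by (rule norm_vector_matrix_mult_le)
  also have "\<dots> \<le> max_jacobian A \<rho> * dual_bound A x\<^sub>1 y\<^sub>0 \<sigma>\<^sub>1"
    using spectral_norm_jacobian_le_max[OF A_lip \<rho>] norm_dual_le_dual_bound[OF run \<sigma>\<^sub>1 k]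
      spectral_norm_nonneg[of J]
    by (intro mult_mono) (auto simp: J_def x_def y_def)
  finally have y: "norm (y v* J) \<le> max_jacobian A \<rho> * dual_bound A x\<^sub>1 y\<^sub>0 \<sigma>\<^sub>1" .
  have "\<nu> * \<beta> k * norm (A x) \<le> \<beta> k * norm (A x v* J)"
    using reg \<beta> by (simp add: x_def J_def mult_ac)
  also have "\<dots> = norm ((gradient f x + y v* J + \<beta> k *\<^sub>R (A x v* J)) - gradient f x - y v* J)"
    using \<beta> by simp
  also have "\<dots> \<le> norm (gradient f x + y v* J + \<beta> k *\<^sub>R (A x v* J)) + norm (gradient f x)
      + norm (y v* J)"
    by (meson add_right_mono norm_triangle_ineq4 order_trans)
  also have "\<dots> \<le> 1 + max_gradient f \<rho> + max_jacobian A \<rho> * dual_bound A x\<^sub>1 y\<^sub>0 \<sigma>\<^sub>1"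
    using g y norm_gradient_le_max[OF f_lip \<rho>] by (simp add: x_def)
  finally show ?thesis
    using \<nu> \<beta> by (simp add: x_def field_simps)
qed

section \<open>Counting oracle calls\<close>

text \<open>The constant c = q / (q - 1) solves c / q + 1 = c, which is what the induction step
  requires.\<close>

lemma sum_power_le_last:
  fixes q :: real
  assumes "1 < q"
  shows "(\<Sum>k = 1..n. q ^ k) \<le> q / (q - 1) * q ^ n"
proof (induction n)
  case (Suc n)
  have "(\<Sum>k = 1..Suc n. q ^ k) \<le> q / (q - 1) * q ^ n + q ^ Suc n"
    using Suc by simp
  also have "\<dots> = q / (q - 1) * q ^ Suc n"
    using assms by (simp add: field_simps)
  finally show ?case .
qed (use assms in simp)

lemma ialm_oracle_complexity:
  assumes run: "is_ialm_run f A \<beta> x\<^sub>1 y\<^sub>0 \<sigma>\<^sub>1 r"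
    and b: "1 < b" and \<beta>: "\<forall>k. \<beta> k = b ^ k" and K: "1 \<le> K"
    and feasible: "\<And>k. 1 \<le> k \<Longrightarrow> norm (A (iter r (k + 1))) \<le> K / \<beta> k"
    and bdd: "\<And>k. 1 \<le> k \<Longrightarrow> bdd_below (range (aug_lagrangian f A (\<beta> k) (dual r k)))"
    and gap: "\<And>k. 1 \<le> k \<Longrightarrow> initial_gap f A \<beta> r k \<le> Lu"
    and trust: "trust_region_guarantee f A \<beta> C C\<^sub>H r"
    and \<epsilon>: "0 < \<epsilon>" "\<epsilon> < 1"
  shows "\<exists>k\<ge>1. second_order_stationary f A \<epsilon> \<epsilon> (\<beta> k) (iter r (k + 1))" (is ?exists)
    and "real (total_calls f A \<beta> r \<epsilon>)
      \<le> \<bar>C\<bar> * C\<^sub>H\<^sup>2 * (b ^ 5 / (b ^ 5 - 1)) * (b * K) ^ 5 * (Lu / \<epsilon> ^ 5)" (is ?calls)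
    and "0 \<le> Lu"
proof -
  have \<beta>_pos: "0 < \<beta> k" for k using b \<beta> by simp
  \<comment> \<open>Boundedness from below makes the infimum a genuine lower bound of the values.
    Nonnegative gaps then allow the cost estimate to be monotone in each factor.\<close>
  have gap_nonneg: "0 \<le> initial_gap f A \<beta> r k" if "1 \<le> k" for k
    unfolding initial_gap_def using bdd[OF that] by (simp add: cINF_lower)
  then show Lu: "0 \<le> Lu"
    using gap[of 1] order_trans by blast
  \<comment> \<open>Two of the five powers of \<open>\<beta> k\<close> come from the squared Hessian
    constant, three from the inverse cubed accuracy.\<close>
  have calls: "real (calls r k) \<le> \<bar>C\<bar> * C\<^sub>H\<^sup>2 * Lu * (b ^ 5) ^ k" if k: "1 \<le> k" for k
  proof -
    obtain L\<^sub>H where L: "0 \<le> L\<^sub>H" "L\<^sub>H \<le> C\<^sub>H * \<beta> k"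
      and le: "real (calls r k) \<le> C * (L\<^sub>H\<^sup>2 * initial_gap f A \<beta> r k / accuracy r (k + 1) ^ 3)"
      using trust k unfolding trust_region_guarantee_def spectral_lipschitz_def by blast
    have acc: "accuracy r (k + 1) = 1 / \<beta> k"
      using run k unfolding is_ialm_run_def by blast
    have "real (calls r k) \<le> C * (L\<^sub>H\<^sup>2 * initial_gap f A \<beta> r k * \<beta> k ^ 3)"
      using le unfolding acc by (simp add: power_divide)
    \<comment> \<open>No sign is assumed for \<open>C\<close>, so its absolute value is
      used.\<close>
    also have "\<dots> \<le> \<bar>C\<bar> * (L\<^sub>H\<^sup>2 * initial_gap f A \<beta> r k * \<beta> k ^ 3)"
      using gap_nonneg[OF k] \<beta>_pos[of k] by (intro mult_right_mono) auto
    also have "\<dots> \<le> \<bar>C\<bar> * ((C\<^sub>H * \<beta> k)\<^sup>2 * Lu * \<beta> k ^ 3)"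
      using gap_nonneg[OF k] gap[OF k] \<beta>_pos[of k] L
      by (intro mult_left_mono mult_right_mono mult_mono power_mono) auto
    also have "\<dots> = \<bar>C\<bar> * C\<^sub>H\<^sup>2 * Lu * \<beta> k ^ 5"
      by (simp add: power_mult_distrib eval_nat_numeral mult_ac)
    also have "\<beta> k ^ 5 = (b ^ 5) ^ k"
      by (simp add: \<beta> flip: power_mult, simp add: mult.commute)
    finally show ?thesis .
  qed
  obtain n where "K / \<epsilon> < b ^ n"
    using real_arch_pow[OF b] by blast
  moreover have "\<not> K / \<epsilon> \<le> b ^ 0"
    using K \<epsilon> by (simp add: field_simps)
  \<comment> \<open>\<open>Suc m\<close> is the first exponent reaching
    \<open>K / \<epsilon>\<close>; it is positive because \<open>K\<close> is at least 1 and
    \<epsilon> is below 1. Minimality gives the upper bound on \<open>b ^ m\<close> that limits the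
    cost.\<close>
  ultimately obtain m where m: "b ^ m < K / \<epsilon>" "K / \<epsilon> \<le> b ^ Suc m"
    using ex_least_nat_less[of "\<lambda>k. K / \<epsilon> \<le> b ^ k" n] by force
  \<comment> \<open>Since \<open>K\<close> is at least 1, the tolerance is below \<epsilon> as soon
    as the infeasibility bound is.\<close>
  have "1 / \<beta> (Suc m) \<le> K / \<beta> (Suc m)"
    using K \<beta>_pos[of "Suc m"] by (simp add: divide_right_mono)
  moreover have "K / \<beta> (Suc m) \<le> \<epsilon>"
    using m(2) \<epsilon> \<beta>_pos[of "Suc m"] by (simp add: \<beta> field_simps)
  ultimately have "1 / \<beta> (Suc m) \<le> \<epsilon>" "K / \<beta> (Suc m) \<le> \<epsilon>" by linarith+
  moreover have "norm (gradient (aug_lagrangian f A (\<beta> (Suc m)) (dual r (Suc m))) (iter r (Suc m + 1)))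
      \<le> 1 / \<beta> (Suc m)"
    and "- (1 / \<beta> (Suc m))
      \<le> lambda_min (hessian (aug_lagrangian f A (\<beta> (Suc m)) (dual r (Suc m))) (iter r (Suc m + 1)))"
    using run unfolding is_ialm_run_def by (metis (no_types) le_add2 plus_1_eq_Suc le_add1)+
  \<comment> \<open>The multiplier is the one with which the subproblem was solved, before the dual
    update that follows it.\<close>
  ultimately have sosp: "second_order_stationary f A \<epsilon> \<epsilon> (\<beta> (Suc m)) (iter r (Suc m + 1))"
    unfolding second_order_stationary_def using feasible[of "Suc m"]
    by (intro exI[of _ "dual r (Suc m)"]) auto
  then show ?exists
    by (intro exI[of _ "Suc m"]) auto
  have final: "final_iteration f A \<beta> r \<epsilon> \<le> Suc m"
    unfolding final_iteration_def by (rule Least_le) (use sosp in auto)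
  have "real (total_calls f A \<beta> r \<epsilon>) = (\<Sum>k = 1..final_iteration f A \<beta> r \<epsilon>. real (calls r k))"
    by (simp add: total_calls_def)
  also have "\<dots> \<le> (\<Sum>k = 1..Suc m. real (calls r k))"
    by (rule sum_mono2) (use final in auto)
  also have "\<dots> \<le> (\<Sum>k = 1..Suc m. \<bar>C\<bar> * C\<^sub>H\<^sup>2 * Lu * (b ^ 5) ^ k)"
    by (intro sum_mono calls) auto
  also have "\<dots> = \<bar>C\<bar> * C\<^sub>H\<^sup>2 * Lu * (\<Sum>k = 1..Suc m. (b ^ 5) ^ k)"
    by (rule sum_distrib_left [symmetric])
  also have "\<dots> \<le> \<bar>C\<bar> * C\<^sub>H\<^sup>2 * Lu * (b ^ 5 / (b ^ 5 - 1) * (b ^ 5) ^ Suc m)"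
    using b Lu by (intro mult_left_mono sum_power_le_last) (auto simp: one_less_power)
  also have "(b ^ 5) ^ Suc m = (b * b ^ m) ^ 5"
    by (simp flip: power_mult power_Suc, simp add: mult.commute)
  \<comment> \<open>The last penalty exceeds \<open>K / \<epsilon>\<close> by less than a factor
    \<open>b\<close>; this explains the power of \<open>b * K\<close> in the constant.\<close>
  also have "\<bar>C\<bar> * C\<^sub>H\<^sup>2 * Lu * (b ^ 5 / (b ^ 5 - 1) * (b * b ^ m) ^ 5)
      \<le> \<bar>C\<bar> * C\<^sub>H\<^sup>2 * Lu * (b ^ 5 / (b ^ 5 - 1) * (b * (K / \<epsilon>)) ^ 5)"
    using b Lu m(1) one_less_power[OF b, of 5]
    by (intro mult_left_mono power_mono) auto
  finally show ?calls
    by (simp add: power_divide power_mult_distrib mult_ac)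
qed

(* R collects all pairs of an admissible run r and an admissible bound Lu. Big-O along the product
   filter at_right 0 x principal R is big-O as eps -> 0+ with one constant for all (r, Lu) in R;
   in particular the constant does not depend on Lu. *)
theorem corollary4p3:
  fixes f :: "real^'d \<Rightarrow> real" and A :: "real^'d \<Rightarrow> real^'m"
    and x\<^sub>1 :: "real^'d" and y\<^sub>0 :: "real^'m" and \<beta> :: "nat \<Rightarrow> real"
    and L\<^sub>f L\<^sub>A b \<sigma>\<^sub>1 \<nu> \<rho> C C\<^sub>H Q' :: real
    and R :: "(('d, 'm) ialm_run \<times> real) set"
  assumes f_diff: "\<forall>x. f differentiable at x" "\<forall>x. gradient f differentiable at x"
    and A_diff: "\<forall>x. A differentiable at x" "\<forall>x. (\<lambda>z. jacobian A (at z)) differentiable at x"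
    and f_lip: "L\<^sub>f-lipschitz_on UNIV (gradient f)"
    and A_lip: "spectral_lipschitz L\<^sub>A (\<lambda>x. jacobian A (at x))"
    and b: "b > 1" and \<beta>: "\<forall>k. \<beta> k = b ^ k"
    and \<sigma>\<^sub>1: "\<sigma>\<^sub>1 > 0" and \<nu>: "\<nu> > 0"
    and Q': "Q' = (\<nu> + \<sigma>\<^sub>1 * sqrt (real CARD('m)) * L\<^sub>A *
                 (2 * max_gradient f \<rho> + 2 * max_jacobian A \<rho> * dual_bound A x\<^sub>1 y\<^sub>0 \<sigma>\<^sub>1)) / \<nu>"
    and R: "R = {(r, Lu).
        is_ialm_run f A \<beta> x\<^sub>1 y\<^sub>0 \<sigma>\<^sub>1 r \<and>
        bdd_above ((\<lambda>k. norm (iter r k)) ` {2..}) \<and> \<rho> = (SUP k\<in>{2..}. norm (iter r k)) \<and>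
        (\<forall>k\<ge>2. \<nu> * norm (A (iter r k))
                \<le> norm (transpose (jacobian A (at (iter r k))) *v A (iter r k))) \<and>
        (\<forall>k\<ge>1. bdd_below (range (aug_lagrangian f A (\<beta> k) (dual r k)))) \<and>
        (\<forall>k\<ge>1. initial_gap f A \<beta> r k \<le> Lu) \<and>
        trust_region_guarantee f A \<beta> C C\<^sub>H r}"
  shows "(\<forall>\<^sub>F \<epsilon> in at_right 0. \<forall>(r, Lu)\<in>R.
            \<exists>k\<ge>1. second_order_stationary f A \<epsilon> \<epsilon> (\<beta> k) (iter r (k + 1))) \<and>
         (\<lambda>(\<epsilon>, r, Lu). real (total_calls f A \<beta> r \<epsilon>))
            \<in> O[at_right 0 \<times>\<^sub>F principal R](\<lambda>(\<epsilon>, r, Lu). Lu * Q' ^ 5 / \<epsilon> ^ 5 * log b (Q' / \<epsilon>)) \<and>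
         (\<exists>p::nat. (\<lambda>(\<epsilon>, r, Lu). real (total_calls f A \<beta> r \<epsilon>))
            \<in> O[at_right 0 \<times>\<^sub>F principal R](\<lambda>(\<epsilon>, r, Lu). Lu * Q' ^ 5 / \<epsilon> ^ 5 * ln (1 / \<epsilon>) ^ p))"
proof -
  define G J Y where "G = max_gradient f \<rho>" and "J = max_jacobian A \<rho>"
    and "Y = dual_bound A x\<^sub>1 y\<^sub>0 \<sigma>\<^sub>1"
  \<comment> \<open>The maximum with 1 lets \<open>K / \<beta> k\<close> dominate both the
    infeasibility and the tolerance.\<close>
  define K where "K = max 1 ((1 + G + J * Y) / \<nu>)"
  \<comment> \<open>The implied constant is fixed before \<epsilon>, the run and \<open>Lu\<close>
    are chosen.\<close>
  define M where "M = \<bar>C\<bar> * C\<^sub>H\<^sup>2 * (b ^ 5 / (b ^ 5 - 1)) * (b * K) ^ 5"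
  \<comment> \<open>Below \<open>1 / b\<close>, and with \<open>Q'\<close> at least 1, the logarithm
    of \<open>Q' / \<epsilon>\<close> to base \<open>b\<close> is at least 1.\<close>
  define \<epsilon>\<^sub>0 where "\<epsilon>\<^sub>0 = 1 / b"
  have \<epsilon>\<^sub>0: "0 < \<epsilon>\<^sub>0" "\<epsilon>\<^sub>0 < 1" using b by (auto simp: \<epsilon>\<^sub>0_def)
  have small: "\<forall>\<^sub>F \<epsilon> in at_right 0. 0 < \<epsilon> \<and> \<epsilon> < \<epsilon>\<^sub>0"
    using eventually_at_right_real[OF \<epsilon>\<^sub>0(1)] by simp
  have bound: "(\<exists>k\<ge>1. second_order_stationary f A \<epsilon> \<epsilon> (\<beta> k) (iter r (k + 1))) \<and>
      real (total_calls f A \<beta> r \<epsilon>) \<le> M * (Lu / \<epsilon> ^ 5) \<and> 0 \<le> Lu \<and> 1 \<le> Q'"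
    if \<epsilon>: "0 < \<epsilon> \<and> \<epsilon> < \<epsilon>\<^sub>0" and "(r, Lu) \<in> R" for \<epsilon> r Lu
  proof -
    have run: "is_ialm_run f A \<beta> x\<^sub>1 y\<^sub>0 \<sigma>\<^sub>1 r"
      and bdd: "bdd_above ((\<lambda>k. norm (iter r k)) ` {2..})"
      and \<rho>: "\<rho> = (SUP k\<in>{2..}. norm (iter r k))"
      and reg: "\<forall>k\<ge>2. \<nu> * norm (A (iter r k))
        \<le> norm (transpose (jacobian A (at (iter r k))) *v A (iter r k))"
      and below: "\<forall>k\<ge>1. bdd_below (range (aug_lagrangian f A (\<beta> k) (dual r k)))"
      and gap: "\<forall>k\<ge>1. initial_gap f A \<beta> r k \<le> Lu"
      and trust: "trust_region_guarantee f A \<beta> C C\<^sub>H r"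
      using \<open>(r, Lu) \<in> R\<close> unfolding R by auto
    have iter_le: "norm (iter r k) \<le> \<rho>" if "2 \<le> k" for k
      unfolding \<rho> using bdd that by (intro cSUP_upper) auto
    \<comment> \<open>A supremum is seen to be nonnegative from one point of the ball; the iterate
      with index 2 supplies it.\<close>
    have GJ: "0 \<le> G" "0 \<le> J"
      using order_trans[OF norm_ge_zero norm_gradient_le_max[OF f_lip iter_le[of 2]]]
        order_trans[OF spectral_norm_nonneg spectral_norm_jacobian_le_max[OF A_lip iter_le[of 2]]]
      by (auto simp: G_def J_def)
    have Y: "0 \<le> Y"
      unfolding Y_def using \<sigma>\<^sub>1 by (intro dual_bound_nonneg) simp
    have "0 \<le> L\<^sub>A"
      using A_lip unfolding spectral_lipschitz_def by blast
    then have "1 \<le> Q'"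
      unfolding Q' G_def[symmetric] J_def[symmetric] Y_def[symmetric]
      using GJ Y \<sigma>\<^sub>1 \<nu> by simp
    moreover have "norm (A (iter r (k + 1))) \<le> K / \<beta> k" if k: "1 \<le> k" for k
    proof -
      have "norm (A (iter r (k + 1))) \<le> (1 + G + J * Y) / \<nu> / \<beta> k"
        unfolding G_def J_def Y_def
        by (rule ialm_infeasibility_le[OF run _ k f_diff(1) A_diff(1) f_lip A_lip])
          (use \<sigma>\<^sub>1 \<nu> b \<beta> k reg iter_le in auto)
      also have "\<dots> \<le> K / \<beta> k"
        using b \<beta> by (intro divide_right_mono) (auto simp: K_def)
      finally show ?thesis .
    qed
    moreover have "1 \<le> K" by (simp add: K_def)
    ultimately show ?thesis
      using ialm_oracle_complexity[OF run b \<beta>, of K Lu C C\<^sub>H \<epsilon>] below gap trust \<epsilon> \<epsilon>\<^sub>0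
      by (auto simp: M_def)
  qed
  have prod: "\<forall>\<^sub>F z in at_right 0 \<times>\<^sub>F principal R.
      (0 < fst z \<and> fst z < \<epsilon>\<^sub>0) \<and> snd z \<in> R"
    unfolding eventually_prod_filter
    using small by (intro exI[of _ "\<lambda>\<epsilon>. 0 < \<epsilon> \<and> \<epsilon> < \<epsilon>\<^sub>0"] exI[of _ "\<lambda>z. z \<in> R"])
      (auto simp: eventually_principal)
  have stationary: "\<forall>\<^sub>F \<epsilon> in at_right 0. \<forall>(r, Lu)\<in>R.
      \<exists>k\<ge>1. second_order_stationary f A \<epsilon> \<epsilon> (\<beta> k) (iter r (k + 1))"
    using small by eventually_elim (use bound in blast)
  \<comment> \<open>Both complexity claims are instances, with \<open>W\<close> the logarithmic
    factor. \<open>1 \<le> Q'\<close> is a premise on \<open>W\<close> because it is derived from a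
    member of \<open>R\<close>.\<close>
  have calls: "(\<lambda>(\<epsilon>, r, Lu). real (total_calls f A \<beta> r \<epsilon>))
      \<in> O[at_right 0 \<times>\<^sub>F principal R](\<lambda>(\<epsilon>, r, Lu). Lu * Q' ^ 5 / \<epsilon> ^ 5 * W \<epsilon>)"
    if W: "\<And>\<epsilon>. 0 < \<epsilon> \<Longrightarrow> \<epsilon> < \<epsilon>\<^sub>0 \<Longrightarrow> 1 \<le> Q' \<Longrightarrow> 1 \<le> W \<epsilon>" for W
  proof (rule bigoI[where c = M], use prod in eventually_elim)
    fix z assume z: "(0 < fst z \<and> fst z < \<epsilon>\<^sub>0) \<and> snd z \<in> R"
    obtain \<epsilon> r Lu where z_eq: "z = (\<epsilon>, r, Lu)" by (rule prod_cases3)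
    with z have \<epsilon>: "0 < \<epsilon>" "\<epsilon> < \<epsilon>\<^sub>0" and "(r, Lu) \<in> R" by auto
    then have calls: "real (total_calls f A \<beta> r \<epsilon>) \<le> M * (Lu / \<epsilon> ^ 5)"
      and Lu: "0 \<le> Lu" and Q: "1 \<le> Q'"
      using bound by blast+
    have "0 \<le> M"
      unfolding M_def K_def using b one_less_power[OF b, of 5] by simp
    have W1: "1 \<le> W \<epsilon>"
      using W \<epsilon> Q by blast
    \<comment> \<open>The factors \<open>Q' ^ 5\<close> and \<open>W \<epsilon>\<close> only enlarge
      the bound already proved.\<close>
    have "1 * 1 \<le> Q' ^ 5 * W \<epsilon>"
      using Q W1 by (intro mult_mono one_le_power) auto
    then have "Lu / \<epsilon> ^ 5 * 1 \<le> Lu / \<epsilon> ^ 5 * (Q' ^ 5 * W \<epsilon>)"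
      using Lu \<epsilon> by (intro mult_left_mono) auto
    then have "M * (Lu / \<epsilon> ^ 5) \<le> M * (Lu * Q' ^ 5 / \<epsilon> ^ 5 * W \<epsilon>)"
      using \<open>0 \<le> M\<close> by (intro mult_left_mono) auto
    with calls show "norm (case z of (\<epsilon>, r, Lu) \<Rightarrow> real (total_calls f A \<beta> r \<epsilon>))
        \<le> M * norm (case z of (\<epsilon>, r, Lu) \<Rightarrow> Lu * Q' ^ 5 / \<epsilon> ^ 5 * W \<epsilon>)"
      using Lu Q W1 \<epsilon> by (simp add: z_eq abs_mult)
  qed
  have "1 \<le> log b (Q' / \<epsilon>)" if "0 < \<epsilon>" "\<epsilon> < \<epsilon>\<^sub>0" "1 \<le> Q'" for \<epsilon>
  proof -
    have "b * \<epsilon> \<le> 1"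
      using that b by (simp add: \<epsilon>\<^sub>0_def field_simps)
    then have "b \<le> Q' / \<epsilon>"
      using that by (simp add: field_simps)
    then show ?thesis
      using that b by (simp add: le_log_iff)
  qed
  then have "(\<lambda>(\<epsilon>, r, Lu). real (total_calls f A \<beta> r \<epsilon>))
      \<in> O[at_right 0 \<times>\<^sub>F principal R](\<lambda>(\<epsilon>, r, Lu). Lu * Q' ^ 5 / \<epsilon> ^ 5 * log b (Q' / \<epsilon>))"
    by (rule calls)
  moreover have "\<exists>p::nat. (\<lambda>(\<epsilon>, r, Lu). real (total_calls f A \<beta> r \<epsilon>))
      \<in> O[at_right 0 \<times>\<^sub>F principal R](\<lambda>(\<epsilon>, r, Lu). Lu * Q' ^ 5 / \<epsilon> ^ 5 * ln (1 / \<epsilon>) ^ p)"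
    using calls[of "\<lambda>\<epsilon>. ln (1 / \<epsilon>) ^ 0"] by (intro exI[of _ 0]) simp
  ultimately show ?thesis
    using stationary by blast
qed

end
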